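(* Let $T$ be a finite tree, let $\mathcal{P}$ be any partition of $T$, and let $\overline{T}$ be the vertex-weighted partition-graph induced by $\mathcal{P}$. Then every super-vertex in the median of $\overline{T}$ contains a vertex in the median of $T$.
   Context: A partition of $T$ is a partition of $V(T)$ into nonempty subsets (super-vertices) each inducing a connected subgraph. The vertex-weighted partition-graph $\overline{T}$ has the super-vertices as vertices, two distinct super-vertices adjacent iff some vertex of one is adjacent in $T$ to some vertex of the other, and each super-vertex $X$ has weight $f(X)=|X|$. In a vertex-weighted graph with positive weights $f$, the vertex-weighted distance-sum of $x$ is $\mathrm{ds}^w(x)=\sum_{v}d(x,v)f(v)$ and the median is the set of vertices minimizing $\mathrm{ds}^w$. The median of the (unweighted) tree $T$ is the set of vertices minimizing $\mathrm{ds}(v)=\sum_{x\in V(T)}d(v,x)$. Distances are shortest-path distances. *)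

theory Defs
  imports
    "Graph_Theory.Digraph_Component"
    "Graph_Theory.Shortest_Path"
    "HOL-Library.Disjoint_Sets"
begin

text \<open>
  Finite simple undirected graphs are the \<open>pair_graph\<close>s of the library: finite, loop-free,
  symmetric digraphs whose arcs are pairs of vertices, each edge being present as two opposite arcs.

  The library predicate \<open>tree\<close> cannot be used for them: it forbids every directed cycle, and in a
  symmetric digraph each edge \<open>a, b\<close> already gives the directed cycle \<open>a, b, a\<close>. The cycles of the
  undirected graph are exactly the directed cycles of length at least 3.
  The library's \<open>connected\<close> includes that there is at least one vertex.
\<close>

definition finite_tree :: "'a pair_pre_digraph \<Rightarrow> bool" where
  "finite_tree T \<longleftrightarrow>
     pair_graph T \<and>
     Digraph_Component.connected (with_proj T) \<and>
     \<not> (\<exists>c. pre_digraph.cycle (with_proj T) c \<and> length c \<ge> 3)"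

text \<open>
  \<open>\<mu>\<close> is the infimum of the costs of all walks; with unit costs this is the
  number of edges of a shortest path, and \<open>\<infinity>\<close> if there is no path at all.
\<close>

definition graph_dist :: "('a, 'b) pre_digraph \<Rightarrow> 'a \<Rightarrow> 'a \<Rightarrow> ereal" where
  "graph_dist G u v = wf_digraph.\<mu> G (\<lambda>_. 1) u v"

definition distance_sum :: "('a, 'b) pre_digraph \<Rightarrow> 'a \<Rightarrow> ereal" where
  "distance_sum G v = (\<Sum>x\<in>verts G. graph_dist G v x)"

definition median :: "('a, 'b) pre_digraph \<Rightarrow> 'a set" where
  "median G = {v \<in> verts G. \<forall>u \<in> verts G. distance_sum G v \<le> distance_sum G u}"

definition weighted_distance_sum :: "('a, 'b) pre_digraph \<Rightarrow> ('a \<Rightarrow> real) \<Rightarrow> 'a \<Rightarrow> ereal" where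
  "weighted_distance_sum G f x = (\<Sum>v\<in>verts G. graph_dist G x v * ereal (f v))"

definition weighted_median :: "('a, 'b) pre_digraph \<Rightarrow> ('a \<Rightarrow> real) \<Rightarrow> 'a set" where
  "weighted_median G f =
     {x \<in> verts G. \<forall>y \<in> verts G. weighted_distance_sum G f x \<le> weighted_distance_sum G f y}"

definition graph_partition :: "'a pair_pre_digraph \<Rightarrow> 'a set set \<Rightarrow> bool" where
  "graph_partition T P \<longleftrightarrow>
     partition_on (pverts T) P \<and>
     (\<forall>X \<in> P. Digraph_Component.connected (with_proj T \<restriction> X))"

definition partition_graph :: "'a pair_pre_digraph \<Rightarrow> 'a set set \<Rightarrow> 'a set pair_pre_digraph" where
  "partition_graph T P =
     \<lparr> pverts = P,
       parcs = {(X, Y). X \<in> P \<and> Y \<in> P \<and> X \<noteq> Y \<and> (\<exists>x\<in>X. \<exists>y\<in>Y. (x, y) \<in> parcs T)} \<rparr>"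

definition supervertex_weight :: "'a set \<Rightarrow> real" where
  "supervertex_weight X = real (card X)"

lemma pair_graph_partition_graph:
  assumes "pair_graph T" "graph_partition T P"
  shows "pair_graph (partition_graph T P)"
proof -
  interpret T: pair_graph T by fact
  have fin: "finite P"
    using assms(2) T.pair_finite_verts
    by (auto simp: graph_partition_def partition_on_def intro: finite_UnionD)
  have sym: "(y, x) \<in> parcs T" if "(x, y) \<in> parcs T" for x y
    using T.graph_symmetric that by simp
  have "parcs (partition_graph T P) \<subseteq> P \<times> P"
    by (auto simp: partition_graph_def)
  then have "finite (parcs (partition_graph T P))"
    using fin by (auto intro: finite_subset)
  moreover have "symmetric (with_proj (partition_graph T P))"
    unfolding symmetric_def sym_def by (auto simp: partition_graph_def dest: sym)
  ultimately show ?thesis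
    using fin by unfold_locales (auto simp: partition_graph_def)
qed

lemma supervertex_weight_pos:
  assumes "pair_graph T" "graph_partition T P" "X \<in> P"
  shows "supervertex_weight X > 0"
proof -
  interpret T: pair_graph T by fact
  have "X \<subseteq> pverts T" "X \<noteq> {}"
    using assms(2,3) by (auto simp: graph_partition_def partition_on_def)
  then show ?thesis
    using T.pair_finite_verts
    by (auto simp: supervertex_weight_def card_gt_0_iff intro: finite_subset)
qed

end

theory Submission
  imports Defs
begin

text \<open>
  Every edge \<open>x y\<close> of a tree is a bridge; let \<open>A\<close> be the side of \<open>x\<close> and \<open>B\<close> the side of \<open>y\<close>.
  For nonnegative vertex weights \<open>w\<close>, the weighted distance-sums satisfy \<open>ds y - ds x = w A - w B\<close>, and
  \<open>ds m - ds x \<ge> d(m, x) (w A - w B)\<close> for every \<open>m\<close> in \<open>B\<close>. If the ends of the bridge lie in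
  different super-vertices \<open>X\<close> and \<open>Y\<close>, then each super-vertex lies on one side, so \<open>X Y\<close> is a
  bridge of the partition-graph with sides of the same weights. Now let \<open>X\<close> be a median of the
  partition-graph and \<open>m\<close> a median of the tree outside \<open>X\<close>, let \<open>x\<close> be a vertex of \<open>X\<close> closest to
  \<open>m\<close>, and \<open>y\<close> the next vertex on a shortest path to \<open>m\<close>. Comparing \<open>X\<close> with \<open>Y\<close> gives
  \<open>w A \<ge> w B\<close>, and therefore \<open>ds x \<le> ds m\<close>.
\<close>

section \<open>Distances in a connected graph\<close>

lemma length_rev_path: "length (rev_path p) = length p"
  by (induction p) auto

text \<open>Reachability makes all distances finite, so sums can be handled in the reals. Both the
  tree and its partition-graph are instances; acyclicity enters only through bridges.\<close>

locale connected_pair_graph = pair_graph G for G :: "'a pair_pre_digraph" +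
  assumes all_reachable: "\<lbrakk>u \<in> pverts G; v \<in> pverts G\<rbrakk> \<Longrightarrow> u \<rightarrow>\<^sup>*\<^bsub>with_proj G\<^esub> v"
begin

text \<open>\<open>real_of_ereal\<close> sends an infinite distance to 0; between vertices this case
  does not occur, by \<open>graph_dist_eq_hops\<close>.\<close>

definition hops :: "'a \<Rightarrow> 'a \<Rightarrow> real" where
  "hops u v = real_of_ereal (graph_dist (with_proj G) u v)"

definition dsum :: "('a \<Rightarrow> real) \<Rightarrow> 'a \<Rightarrow> real" where
  "dsum f u = (\<Sum>v\<in>pverts G. hops u v * f v)"

lemma unit_awalk_cost: "awalk_cost (\<lambda>_. 1) p = real (length p)"
  by (induction p) auto

text \<open>With unit costs, the infimum defining the distance of reachable vertices is attained by
  a path, so distances can be argued about through concrete walks.\<close>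

lemma shortest_awalk:
  assumes "u \<in> pverts G" "v \<in> pverts G"
  obtains p where "awalk u p v" "graph_dist (with_proj G) u v = ereal (length p)" "hops u v = length p"
proof -
  obtain p where "apath u p v" "\<mu> (\<lambda>_. 1) u v = awalk_cost (\<lambda>_. 1) p"
    using min_cost_awalk[OF all_reachable[OF assms], of "\<lambda>_. 1"] by auto
  then show ?thesis
    by (intro that[of p]) (auto simp: apath_def unit_awalk_cost graph_dist_def hops_def)
qed

lemma graph_dist_eq_hops:
  assumes "u \<in> pverts G" "v \<in> pverts G"
  shows "graph_dist (with_proj G) u v = ereal (hops u v)"
  by (rule shortest_awalk[OF assms]) auto

lemma hops_nonneg:
  assumes "u \<in> pverts G" "v \<in> pverts G"
  shows "0 \<le> hops u v"
  by (rule shortest_awalk[OF assms]) auto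

lemma hops_le_length:
  assumes "awalk u p v"
  shows "hops u v \<le> length p"
proof -
  have V: "u \<in> pverts G" "v \<in> pverts G"
    using assms by auto
  show ?thesis
    using min_cost_le_walk_cost[OF assms, of "\<lambda>_. 1"] graph_dist_eq_hops[OF V]
    by (simp add: graph_dist_def unit_awalk_cost)
qed

lemma hops_triangle:
  assumes "u \<in> pverts G" "v \<in> pverts G" "w \<in> pverts G"
  shows "hops u w \<le> hops u v + hops v w"
proof -
  obtain p where p: "awalk u p v" "hops u v = length p"
    using shortest_awalk[OF assms(1,2)] by metis
  obtain q where q: "awalk v q w" "hops v w = length q"
    using shortest_awalk[OF assms(2,3)] by metis
  show ?thesis
    using hops_le_length[OF awalk_appendI[OF p(1) q(1)]] p q by simp
qed

lemma hops_sym: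
  assumes "u \<in> pverts G" "v \<in> pverts G"
  shows "hops u v = hops v u"
proof -
  have "hops b a \<le> hops a b" if ab: "a \<in> pverts G" "b \<in> pverts G" for a b
  proof -
    obtain p where p: "awalk a p b" "hops a b = length p"
      using shortest_awalk[OF ab] by metis
    then have "awalk b (rev_path p) a"
      by simp
    from hops_le_length[OF this] p show ?thesis
      by (simp add: length_rev_path)
  qed
  from this[OF assms] this[OF assms(2,1)] show ?thesis
    by simp
qed

lemma hops_arc:
  assumes "(x, y) \<in> parcs G"
  shows "hops x y = 1"
proof -
  have V: "x \<in> pverts G" "y \<in> pverts G" and "x \<noteq> y"
    using assms by (auto dest: wellformed' no_loops')
  obtain p where p: "awalk x p y" "hops x y = length p"
    using shortest_awalk[OF V] by metis
  then have "p \<noteq> []"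
    using \<open>x \<noteq> y\<close> by (auto dest: awalk_empty_ends)
  then have "1 \<le> length p"
    by (cases p) auto
  moreover have "awalk x [(x, y)] y"
    using assms V by (simp add: awalk_simps)
  from hops_le_length[OF this] have "hops x y \<le> 1"
    by simp
  ultimately show ?thesis
    using p by simp
qed

text \<open>The first arc of a shortest walk leaves a remainder that is one arc shorter.\<close>

lemma shortest_awalk_step:
  assumes "u \<in> pverts G" "v \<in> pverts G" "u \<noteq> v"
  obtains w where "(u, w) \<in> parcs G" "hops w v < hops u v"
proof -
  obtain p where p: "awalk u p v" "hops u v = length p"
    using shortest_awalk[OF assms(1,2)] by metis
  then obtain e q where pq: "p = e # q"
    using \<open>u \<noteq> v\<close> by (cases p) (auto dest: awalk_empty_ends)
  then have "(u, snd e) \<in> parcs G" "awalk (snd e) q v"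
    using p by (auto simp: awalk_Cons_iff)
  with that[of "snd e"] hops_le_length[of "snd e" q v] p pq show ?thesis
    by auto
qed

lemma weighted_distance_sum_eq:
  "u \<in> pverts G \<Longrightarrow> weighted_distance_sum (with_proj G) f u = ereal (dsum f u)"
  by (simp add: weighted_distance_sum_def dsum_def graph_dist_eq_hops)

lemma weighted_median_eq:
  "weighted_median (with_proj G) f = {x \<in> pverts G. \<forall>y\<in>pverts G. dsum f x \<le> dsum f y}"
  by (auto simp: weighted_median_def weighted_distance_sum_eq)

text \<open>Unit weights let the estimates for \<open>dsum\<close> serve both medians.\<close>

lemma median_eq_weighted: "median (with_proj G) = weighted_median (with_proj G) (\<lambda>_. 1)"
  by (simp add: median_def weighted_median_def distance_sum_def weighted_distance_sum_def
      flip: one_ereal_def)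

end

section \<open>Distance-sums on the two sides of a bridge\<close>

text \<open>A bridge is encoded as a cut with a single crossing edge. \<open>only_crossing\<close>
  speaks of arcs leaving \<open>A\<close>; for arcs entering \<open>A\<close> it is applied to the
  reversed arc.\<close>

locale bridge = connected_pair_graph G for G :: "'a pair_pre_digraph" +
  fixes A :: "'a set" and x y :: 'a
  assumes side_subset: "A \<subseteq> pverts G"
    and bridge_arc: "(x, y) \<in> parcs G"
    and x_in: "x \<in> A" and y_notin: "y \<notin> A"
    and only_crossing: "\<lbrakk>(a, b) \<in> parcs G; a \<in> A; b \<notin> A\<rbrakk> \<Longrightarrow> a = x \<and> b = y"
begin

lemma ends_in_verts: "x \<in> pverts G" "y \<in> pverts G"
  using bridge_arc by (auto dest: wellformed')

text \<open>Somewhere along the walk membership in \<open>A\<close> changes, and the arc where this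
  happens joins \<open>x\<close> and \<open>y\<close>.\<close>

lemma crossing_awalk:
  assumes "awalk u p v" "(u \<in> A) \<noteq> (v \<in> A)"
  shows "x \<in> set (awalk_verts u p) \<and> y \<in> set (awalk_verts u p)"
  using assms
proof (induction p arbitrary: u)
  case Nil
  then show ?case by (auto simp: awalk_Nil_iff)
next
  case (Cons e es)
  have e: "(u, snd e) \<in> parcs G" "u = fst e" and es: "awalk (snd e) es v"
    using Cons.prems by (auto simp: awalk_Cons_iff)
  show ?case
  proof (cases "(u \<in> A) = (snd e \<in> A)")
    case True
    then show ?thesis
      using Cons.IH[OF es] Cons.prems(2) by auto
  next
    case False
    then have "{u, snd e} = {x, y}"
      using only_crossing[OF e(1)] only_crossing[OF arcs_symmetric[OF e(1)]] by auto
    moreover have "snd e \<in> set (awalk_verts (snd e) es)"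
      using hd_in_awalk_verts(1)[OF es] .
    ultimately show ?thesis
      using e(2) by (auto simp: doubleton_eq_iff)
  qed
qed

text \<open>A shortest walk between the sides visits both ends of the bridge and can be cut at
  either one.\<close>

lemma hops_across:
  assumes V: "u \<in> pverts G" "v \<in> pverts G" and sides: "(u \<in> A) \<noteq> (v \<in> A)" and z: "z \<in> {x, y}"
  shows "hops u v = hops u z + hops z v"
proof -
  obtain p where p: "awalk u p v" "hops u v = length p"
    using shortest_awalk[OF V] by metis
  have "z \<in> set (awalk_verts u p)"
    using crossing_awalk[OF p(1) sides] z by auto
  then obtain q r where qr: "p = q @ r" "awalk u q z" "awalk z r v"
    using awalk_decomp[OF p(1)] by blast
  then have "hops u z + hops z v \<le> hops u v"
    using hops_le_length[OF qr(2)] hops_le_length[OF qr(3)] p(2) by simp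
  then show ?thesis
    using hops_triangle[of u z v] V z ends_in_verts by auto
qed

lemma sum_split_sides:
  "(\<Sum>v\<in>pverts G. g v) = (\<Sum>v\<in>A. g v) + (\<Sum>v\<in>pverts G - A. g v)"
  for g :: "'a \<Rightarrow> real"
  using sum.subset_diff[OF side_subset pair_finite_verts, of g] by simp

text \<open>Stepping from \<open>x\<close> to \<open>y\<close> moves one hop away from every vertex
  of \<open>A\<close> and one hop closer to every other vertex.\<close>

lemma dsum_bridge_diff: "dsum f y - dsum f x = sum f A - sum f (pverts G - A)"
proof -
  have A: "(hops y v - hops x v) * f v = f v" if "v \<in> A" for v
  proof -
    have "hops y v = hops y x + hops x v"
      using that side_subset ends_in_verts y_notin by (intro hops_across) auto
    then show ?thesis
      using hops_arc[OF arcs_symmetric[OF bridge_arc]] by simp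
  qed
  have B: "(hops y v - hops x v) * f v = - f v" if "v \<in> pverts G - A" for v
  proof -
    have "hops x v = hops x y + hops y v"
      using that ends_in_verts x_in by (intro hops_across) auto
    then show ?thesis
      using hops_arc[OF bridge_arc] by simp
  qed
  have "dsum f y - dsum f x = (\<Sum>v\<in>pverts G. (hops y v - hops x v) * f v)"
    by (simp add: dsum_def sum_subtractf left_diff_distrib)
  also have "\<dots> = (\<Sum>v\<in>A. f v) + (\<Sum>v\<in>pverts G - A. - f v)"
    unfolding sum_split_sides using A B by (intro arg_cong2[where f = "(+)"] sum.cong) auto
  finally show ?thesis
    by (simp add: sum_negf)
qed

text \<open>Seen from \<open>m\<close> instead of \<open>x\<close>, vertices of \<open>A\<close> are
  farther by exactly \<open>hops m x\<close>, and by the triangle inequality the others are closer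
  by at most that amount.\<close>

lemma dsum_beyond_bridge:
  assumes m: "m \<in> pverts G" "m \<notin> A" and nonneg: "\<And>v. v \<in> pverts G \<Longrightarrow> 0 \<le> f v"
  shows "hops m x * (sum f A - sum f (pverts G - A)) \<le> dsum f m - dsum f x"
proof -
  have A: "hops m x * f v \<le> (hops m v - hops x v) * f v" if "v \<in> A" for v
    using hops_across[of m v x] that side_subset m by auto
  have B: "- hops m x * f v \<le> (hops m v - hops x v) * f v" if v: "v \<in> pverts G - A" for v
  proof -
    have "hops x v \<le> hops m x + hops m v"
      using hops_triangle[of x m v] hops_sym[of x m] v m ends_in_verts by simp
    then show ?thesis
      using nonneg[of v] v by (intro mult_right_mono) auto
  qed
  have "hops m x * (sum f A - sum f (pverts G - A))
      = (\<Sum>v\<in>A. hops m x * f v) + (\<Sum>v\<in>pverts G - A. - hops m x * f v)"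
    by (simp add: right_diff_distrib sum_distrib_left sum_negf)
  also have "\<dots> \<le> (\<Sum>v\<in>A. (hops m v - hops x v) * f v)
      + (\<Sum>v\<in>pverts G - A. (hops m v - hops x v) * f v)"
    by (intro add_mono sum_mono A B)
  also have "\<dots> = dsum f m - dsum f x"
    unfolding sum_split_sides[symmetric] by (simp add: dsum_def sum_subtractf left_diff_distrib)
  finally show ?thesis .
qed

text \<open>A walk inside \<open>Z\<close> between the sides would visit both \<open>x\<close> and
  \<open>y\<close>.\<close>

lemma connected_subset_on_one_side:
  assumes conn: "Digraph_Component.connected (with_proj G \<restriction> Z)" and Z: "Z \<subseteq> pverts G"
    and not_both: "\<not> (x \<in> Z \<and> y \<in> Z)"
  shows "Z \<subseteq> A \<or> Z \<inter> A = {}"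
proof (rule ccontr)
  assume "\<not> ?thesis"
  then obtain a b where ab: "a \<in> Z" "a \<in> A" "b \<in> Z" "b \<notin> A"
    by auto
  interpret Z: wf_digraph "with_proj G \<restriction> Z"
    by (rule wellformed_induce_subgraph)
  have ind: "induced_subgraph (with_proj G \<restriction> Z) (with_proj G)"
    using Z by (intro induced_induce) simp
  \<comment> \<open>\<open>connected\<close> ignores arc directions; symmetry of the induced
    subgraph turns it into reachability by directed walks.\<close>
  have "symmetric (with_proj G \<restriction> Z)"
    using induced_graph_imp_symmetric[OF sym_arcs ind] .
  then have "strongly_connected (with_proj G \<restriction> Z)"
    using conn by (rule Z.symmetric_connected_imp_strongly_connected)
  then have "a \<rightarrow>\<^sup>*\<^bsub>with_proj G \<restriction> Z\<^esub> b"
    using ab by (auto elim!: strongly_connectedE)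
  then obtain p where p: "Z.awalk a p b"
    by (auto simp: Z.reachable_awalk)
  then have "awalk a p b"
    using subgraph_awalk_imp_awalk[OF _ induced_imp_subgraph[OF ind]] by simp
  then have "x \<in> set (awalk_verts a p)" "y \<in> set (awalk_verts a p)"
    using crossing_awalk ab by auto
  moreover have "set (awalk_verts a p) \<subseteq> Z"
  proof -
    have "set (Z.awalk_verts a p) \<subseteq> Z"
      using p by (auto elim!: Z.awalkE')
    then show ?thesis
      using awalk_verts_induce[of Z] by simp
  qed
  ultimately show False
    using not_both by auto
qed

end

section \<open>Tree edges are bridges\<close>

lemma finite_tree_connected_pair_graph:
  assumes "finite_tree T"
  shows "connected_pair_graph T"
proof -
  interpret pair_graph T
    using assms by (simp add: finite_tree_def)
  have "strongly_connected (with_proj T)"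
    using assms sym_arcs symmetric_connected_imp_strongly_connected
    by (simp add: finite_tree_def)
  then show ?thesis
    by unfold_locales (auto elim: strongly_connectedE)
qed

text \<open>A walk from \<open>x\<close> to \<open>y\<close> avoiding the edge, shortened to a path
  and closed by \<open>(y, x)\<close>, would be a forbidden cycle.\<close>

lemma finite_tree_bridge:
  assumes tree: "finite_tree T" and xy: "(x, y) \<in> parcs T"
  obtains A where "bridge T A x y"
proof -
  interpret connected_pair_graph T
    using tree by (rule finite_tree_connected_pair_graph)
  have V: "x \<in> pverts T" "y \<in> pverts T" and "x \<noteq> y"
    using xy by (auto dest: wellformed' no_loops')
  \<comment> \<open>The component of \<open>x\<close> after deleting both arcs of the edge.\<close>
  define A where "A = {v. \<exists>p. awalk x p v \<and> (x, y) \<notin> set p \<and> (y, x) \<notin> set p}"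
  have "x \<in> A"
    unfolding A_def using V by (auto intro!: exI[of _ "[]"] simp: awalk_Nil_iff)
  have "y \<notin> A"
  proof
    assume "y \<in> A"
    then obtain p where p: "awalk x p y" "(x, y) \<notin> set p"
      by (auto simp: A_def)
    define q where "q = awalk_to_apath p"
    have q: "apath x q y" "(x, y) \<notin> set q"
      using apath_awalk_to_apath[OF p(1)] awalk_to_apath_subset[OF p(1)] p(2)
      by (auto simp: q_def)
    then have aq: "awalk x q y" and dq: "distinct (awalk_verts x q)"
      by (auto simp: apath_def)
    \<comment> \<open>An empty path would give \<open>x = y\<close>, and a single arc would be the
      avoided \<open>(x, y)\<close>. The closing arc then brings the length to 3.\<close>
    have "2 \<le> length q"
    proof (rule ccontr)
      assume "\<not> 2 \<le> length q"
      then consider "q = []" | e where "q = [e]"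
        by (cases q; cases "tl q") auto
      then show False
        using aq q(2) \<open>x \<noteq> y\<close> by cases (auto simp: awalk_simps)
    qed
    have c: "awalk x (q @ [(y, x)]) x"
      using aq arcs_symmetric[OF xy] V by (intro awalk_appendI) (auto simp: awalk_simps)
    have "awalk_verts x (q @ [(y, x)]) = awalk_verts x q @ [x]"
      using awalk_verts_append[OF c] aq by simp
    moreover have "awalk_verts x q = x # tl (awalk_verts x q)"
      using aq by (metis awhd_of_awalk awalk_verts_non_Nil list.collapse)
    \<comment> \<open>The tail of the closed walk's vertex list is the vertex list of the path
      \<open>q\<close> rotated by one.\<close>
    ultimately have "distinct (tl (awalk_verts x (q @ [(y, x)])))"
      using dq by (metis append_Cons distinct.simps(2) distinct1_rotate list.sel(3) rotate1.simps(2))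
    then have "cycle (q @ [(y, x)])"
      using c by (auto simp: cycle_def)
    moreover have "3 \<le> length (q @ [(y, x)])"
      using \<open>2 \<le> length q\<close> by simp
    ultimately show False
      using tree unfolding finite_tree_def by blast
  qed
  have "a = x \<and> b = y" if ab: "(a, b) \<in> parcs T" "a \<in> A" "b \<notin> A" for a b
  proof -
    obtain p where p: "awalk x p a" "(x, y) \<notin> set p" "(y, x) \<notin> set p"
      using ab by (auto simp: A_def)
    \<comment> \<open>This walk ends outside \<open>A\<close>, so it uses a deleted arc, which must
      be \<open>(a, b)\<close>. It is not \<open>(y, x)\<close>, as \<open>a\<close> lies in
      \<open>A\<close> and \<open>y\<close> does not.\<close>
    have "awalk x (p @ [(a, b)]) b"
      using p(1) ab(1) by (intro awalk_appendI) (auto simp: awalk_simps dest: wellformed')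
    then have "(x, y) \<in> set (p @ [(a, b)]) \<or> (y, x) \<in> set (p @ [(a, b)])"
      using ab(3) unfolding A_def by blast
    then show ?thesis
      using p ab(2) \<open>y \<notin> A\<close> by auto
  qed
  moreover have "A \<subseteq> pverts T"
    by (auto simp: A_def)
  ultimately have "bridge T A x y"
    using xy \<open>x \<in> A\<close> \<open>y \<notin> A\<close> by unfold_locales blast+
  then show ?thesis ..
qed

section \<open>Connectedness of the partition-graph\<close>

text \<open>A walk projects to super-vertices: each arc stays inside one of them or yields an arc of
  the partition-graph.\<close>

lemma (in connected_pair_graph) connected_partition_graph:
  assumes part: "graph_partition G P"
  shows "connected_pair_graph (partition_graph G P)"
proof -
  have P: "partition_on (pverts G) P"
    using part by (simp add: graph_partition_def)
  interpret Q: pair_graph "partition_graph G P"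
    using part by (intro pair_graph_partition_graph pair_graph)
  have reach: "U \<rightarrow>\<^sup>*\<^bsub>with_proj (partition_graph G P)\<^esub> W"
    if "u \<rightarrow>\<^sup>*\<^bsub>with_proj G\<^esub> w" "u \<in> U" "U \<in> P" "w \<in> W" "W \<in> P" for u w U W
    using that
  proof (induction arbitrary: U rule: converse_reachable_induct)
    case base
    then have "U = W"
      using partition_onD2[OF P] by (auto dest: disjointD)
    moreover have "W \<in> pverts (partition_graph G P)"
      using base.prems by (simp add: partition_graph_def)
    ultimately show ?case
      by simp
  next
    case (step u v)
    then have uv: "(u, v) \<in> parcs G"
      by simp
    then obtain V where V: "v \<in> V" "V \<in> P"
      using partition_onD1[OF P] by (auto dest: wellformed')
    note VW = step.IH[OF V step.prems(3,4)]
    show ?case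
    proof (cases "U = V")
      case False
      then have "(U, V) \<in> parcs (partition_graph G P)"
        using uv V step.prems by (auto simp: partition_graph_def)
      then show ?thesis
        using Q.adj_reachable_trans[OF _ VW] by simp
    qed (use VW in simp)
  qed
  show ?thesis
  proof unfold_locales
    fix U W assume "U \<in> pverts (partition_graph G P)" "W \<in> pverts (partition_graph G P)"
    then have UW: "U \<in> P" "W \<in> P"
      by (auto simp: partition_graph_def)
    then obtain u w where uw: "u \<in> U" "w \<in> W"
      using partition_onD3[OF P] by (metis ex_in_conv)
    then have "u \<in> pverts G" "w \<in> pverts G"
      using UW partition_onD1[OF P] by auto
    then show "U \<rightarrow>\<^sup>*\<^bsub>with_proj (partition_graph G P)\<^esub> W"
      using reach all_reachable uw UW by blast
  qed
qed

section \<open>Bridges carried over to the partition-graph\<close>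

context bridge
begin

context
  fixes P X Y
  assumes part: "graph_partition G P"
    and X: "X \<in> P" "x \<in> X" and Y: "Y \<in> P" "y \<in> Y" and XY: "X \<noteq> Y"
begin

lemma supervertex_on_one_side:
  assumes "Z \<in> P"
  shows "Z \<subseteq> A \<or> Z \<inter> A = {}"
proof (rule connected_subset_on_one_side)
  have P: "partition_on (pverts G) P"
    using part by (simp add: graph_partition_def)
  show "Digraph_Component.connected (with_proj G \<restriction> Z)"
    using part assms by (simp add: graph_partition_def)
  show "Z \<subseteq> pverts G"
    using partition_onD1[OF P] assms by auto
  \<comment> \<open>By disjointness, such a \<open>Z\<close> would equal both \<open>X\<close> and
    \<open>Y\<close>.\<close>
  show "\<not> (x \<in> Z \<and> y \<in> Z)"
    using partition_onD2[OF P] X Y XY assms by (auto dest: disjointD)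
qed

text \<open>An arc leaving the side of \<open>X\<close> is witnessed by an arc of \<open>G\<close>
  leaving \<open>A\<close>, which is \<open>(x, y)\<close>; disjointness then identifies its
  super-vertices as \<open>X\<close> and \<open>Y\<close>.\<close>

lemma bridge_partition_graph: "bridge (partition_graph G P) {Z \<in> P. Z \<subseteq> A} X Y"
proof -
  have P: "partition_on (pverts G) P"
    using part by (simp add: graph_partition_def)
  interpret Q: connected_pair_graph "partition_graph G P"
    using part by (rule connected_partition_graph)
  show ?thesis
  proof unfold_locales
    show "{Z \<in> P. Z \<subseteq> A} \<subseteq> pverts (partition_graph G P)"
      by (auto simp: partition_graph_def)
    show "(X, Y) \<in> parcs (partition_graph G P)"
      using X Y XY bridge_arc by (auto simp: partition_graph_def)
    show "X \<in> {Z \<in> P. Z \<subseteq> A}"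
      using supervertex_on_one_side[OF X(1)] X x_in by auto
    show "Y \<notin> {Z \<in> P. Z \<subseteq> A}"
      using Y y_notin by auto
  next
    fix U W
    assume UW: "(U, W) \<in> parcs (partition_graph G P)" "U \<in> {Z \<in> P. Z \<subseteq> A}" "W \<notin> {Z \<in> P. Z \<subseteq> A}"
    then obtain u w where uw: "u \<in> U" "w \<in> W" "(u, w) \<in> parcs G" and W: "W \<in> P"
      by (auto simp: partition_graph_def)
    then have "u \<in> A" "w \<notin> A"
      using UW supervertex_on_one_side[OF W] by auto
    then have "u = x" "w = y"
      using only_crossing uw by auto
    then show "U = X \<and> W = Y"
      using partition_onD2[OF P] uw UW W X Y by (auto dest: disjointD)
  qed
qed

text \<open>The super-vertices inside \<open>A\<close> partition \<open>A\<close> and the others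
  partition its complement, so cardinalities add up. This transfers the balance of the bridge
  between the two graphs.\<close>

lemma sum_supervertex_weight_sides:
  "sum supervertex_weight {Z \<in> P. Z \<subseteq> A} = card A"
  "sum supervertex_weight (P - {Z \<in> P. Z \<subseteq> A}) = card (pverts G - A)"
proof -
  have P: "partition_on (pverts G) P"
    using part by (simp add: graph_partition_def)
  have fin: "finite Z" if "Z \<in> P" for Z
    using partition_onD1[OF P] that pair_finite_verts by (metis Sup_upper finite_subset)
  have weight: "sum supervertex_weight S = card (\<Union>S)" if "S \<subseteq> P" for S
  proof -
    have "pairwise disjnt S"
      using disjointD[OF partition_onD2[OF P]] that unfolding pairwise_def disjnt_def by blast
    then have "card (\<Union>S) = sum card S"
      using that fin by (intro card_Union_disjoint) auto
    then show ?thesis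
      by (simp add: supervertex_weight_def)
  qed
  have "\<Union>{Z \<in> P. Z \<subseteq> A} = A"
    using supervertex_on_one_side partition_onD1[OF P] side_subset by blast
  then show "sum supervertex_weight {Z \<in> P. Z \<subseteq> A} = card A"
    using weight[of "{Z \<in> P. Z \<subseteq> A}"] by simp
  have "\<Union>(P - {Z \<in> P. Z \<subseteq> A}) = pverts G - A"
    using supervertex_on_one_side partition_onD1[OF P] by blast
  then show "sum supervertex_weight (P - {Z \<in> P. Z \<subseteq> A}) = card (pverts G - A)"
    using weight[of "P - {Z \<in> P. Z \<subseteq> A}"] by simp
qed

end

end

section \<open>Comparison of the two medians\<close>

theorem theorem6:
  fixes T :: "'a pair_pre_digraph" and P :: "'a set set"
  assumes "finite_tree T"
    and "graph_partition T P"
  shows "\<forall>X \<in> weighted_median (with_proj (partition_graph T P)) supervertex_weight.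
           \<exists>v \<in> X. v \<in> median (with_proj T)"
proof
  fix X assume X_median: "X \<in> weighted_median (with_proj (partition_graph T P)) supervertex_weight"
  interpret T: connected_pair_graph T
    using assms(1) by (rule finite_tree_connected_pair_graph)
  interpret Q: connected_pair_graph "partition_graph T P"
    using assms(2) by (rule T.connected_partition_graph)
  have P: "partition_on (pverts T) P"
    using assms(2) by (simp add: graph_partition_def)
  have verts_Q: "pverts (partition_graph T P) = P"
    by (simp add: partition_graph_def)
  have X: "X \<in> P"
    using X_median by (simp add: weighted_median_def verts_Q)
  then have X_verts: "X \<subseteq> pverts T" and "X \<noteq> {}"
    using partition_onD1[OF P] partition_onD3[OF P] by auto
  then have "finite X"
    using T.pair_finite_verts by (auto intro: finite_subset)

  have median_T: "median (with_proj T)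
      = {v \<in> pverts T. \<forall>u\<in>pverts T. T.dsum (\<lambda>_. 1) v \<le> T.dsum (\<lambda>_. 1) u}"
    by (simp add: T.median_eq_weighted T.weighted_median_eq)
  have "pverts T \<noteq> {}"
    using X_verts \<open>X \<noteq> {}\<close> by auto
  then obtain m where m: "m \<in> pverts T" "\<And>u. u \<in> pverts T \<Longrightarrow> T.dsum (\<lambda>_. 1) m \<le> T.dsum (\<lambda>_. 1) u"
    using ex_min_if_finite[of "T.dsum (\<lambda>_. 1) ` pverts T"] T.pair_finite_verts
    by (auto simp: not_less)
  show "\<exists>v\<in>X. v \<in> median (with_proj T)"
  proof (cases "m \<in> X")
    case True
    then show ?thesis
      using m by (auto simp: median_T)
  next
    case False
    \<comment> \<open>Choosing \<open>x\<close> closest to \<open>m\<close> forces the next vertex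
      \<open>y\<close> towards \<open>m\<close> out of \<open>X\<close>, so the edge joins different
      super-vertices.\<close>
    obtain x where x: "x \<in> X" and closest: "\<And>z. z \<in> X \<Longrightarrow> T.hops x m \<le> T.hops z m"
      using ex_min_if_finite[of "(\<lambda>z. T.hops z m) ` X"] \<open>finite X\<close> \<open>X \<noteq> {}\<close>
      by (auto simp: not_less)
    have x_vert: "x \<in> pverts T" and "x \<noteq> m"
      using x X_verts False by auto
    then obtain y where xy: "(x, y) \<in> parcs T" and nearer: "T.hops y m < T.hops x m"
      using T.shortest_awalk_step m(1) by metis
    have y_vert: "y \<in> pverts T"
      using xy by (rule T.wellformed')
    then obtain Y where Y: "Y \<in> P" "y \<in> Y"
      using partition_onD1[OF P] by auto
    have "y \<notin> X"
      using closest[of y] nearer by auto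
    then have "X \<noteq> Y"
      using Y by auto
    obtain A where "bridge T A x y"
      using finite_tree_bridge[OF assms(1) xy] .
    then interpret B: bridge T A x y .
    interpret BQ: bridge "partition_graph T P" "{Z \<in> P. Z \<subseteq> A}" X Y
      using B.bridge_partition_graph[OF assms(2) X x Y \<open>X \<noteq> Y\<close>] .
    \<comment> \<open>Otherwise a shortest walk from \<open>y\<close> to \<open>m\<close> would pass
      through \<open>x\<close>, making \<open>y\<close> one hop farther from \<open>m\<close> than
      \<open>x\<close>.\<close>
    have "m \<notin> A"
      using T.hops_arc[OF T.arcs_symmetric[OF xy]] B.hops_across[of y m x] nearer y_vert m(1) B.y_notin
      by auto
    have "Q.dsum supervertex_weight X \<le> Q.dsum supervertex_weight Y"
      using X_median Y by (simp add: Q.weighted_median_eq verts_Q)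
    \<comment> \<open>The bridge formula in the partition-graph equates the difference of the
      distance-sums of \<open>Y\<close> and \<open>X\<close> with the difference of these
      cardinalities.\<close>
    then have "card (pverts T - A) \<le> card A"
      using BQ.dsum_bridge_diff[of supervertex_weight]
        B.sum_supervertex_weight_sides[OF assms(2) X x Y \<open>X \<noteq> Y\<close>]
      by (simp add: verts_Q)
    then have "0 \<le> T.hops m x * (real (card A) - real (card (pverts T - A)))"
      using T.hops_nonneg[OF m(1) x_vert] by simp
    also have "\<dots> \<le> T.dsum (\<lambda>_. 1) m - T.dsum (\<lambda>_. 1) x"
      using B.dsum_beyond_bridge[OF m(1) \<open>m \<notin> A\<close>, of "\<lambda>_. 1"] by simp
    finally have "T.dsum (\<lambda>_. 1) x \<le> T.dsum (\<lambda>_. 1) m"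
      by simp
    \<comment> \<open>The distance-sum of \<open>x\<close> is at most the minimum, attained at
      \<open>m\<close>.\<close>
    then have "x \<in> median (with_proj T)"
      using m x_vert by (force simp: median_T)
    then show ?thesis
      using x by blast
  qed
qed

end
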